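(* Let $G$ be a finite group with $|G|\ne3$ and $S\subseteq G$ a symmetric generating set of $G$ not containing the identity, with $|S|=d$. If the Cayley graph $C(G,S)$ is non-bipartite, then the largest eigenvalue of its normalised Laplacian matrix is less than $2-\frac{h(G)^4}{2^9d^8}$, where $h(G)$ is the vertex Cheeger constant of $C(G,S)$.
   Context: The Cayley graph $C(G,S)$ has vertex set $G$, with $h$ adjacent to $g$ iff $h=gs$ for some $s\in S$; it is an undirected $d$-regular graph. Its normalised adjacency matrix is $T=A/d$ where $A$ is the adjacency matrix, and its normalised Laplacian is $L=I-T$. For $X\subseteq G$ the vertex boundary is $\delta(X)=XS\setminus X$, and the vertex Cheeger constant is $h(G)=\min\{|\delta(X)|/|X|:\emptyset\ne X\subseteq G,\ |X|\le|G|/2\}$. A graph is bipartite if its vertex set is a union of two disjoint sets each containing no edge. *)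

theory Defs
  imports
    "HOL-Algebra.Generated_Groups"
    "Graph_Theory.Pair_Digraph"
    "Jordan_Normal_Form.Spectral_Radius"
begin

(* Undirected graphs are represented as pair digraphs whose arc relation is symmetric;
   for the Cayley graph, symmetry of the arcs follows from that of S. *)
definition cayley_graph :: "('a, 'b) monoid_scheme \<Rightarrow> 'a set \<Rightarrow> 'a pair_pre_digraph" where
  "cayley_graph G S =
     \<lparr> pverts = carrier G,
       parcs = {(g, h). g \<in> carrier G \<and> h \<in> carrier G \<and> (\<exists>s\<in>S. h = g \<otimes>\<^bsub>G\<^esub> s)} \<rparr>"

definition bipartite :: "'a pair_pre_digraph \<Rightarrow> bool" where
  "bipartite D \<longleftrightarrow>
     (\<exists>U V. pverts D = U \<union> V \<and> U \<inter> V = {} \<and>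
        (\<forall>(x, y)\<in>parcs D. \<not> (x \<in> U \<and> y \<in> U) \<and> \<not> (x \<in> V \<and> y \<in> V)))"

(* Matrices are indexed by 0, ..., n - 1, so the vertices are enumerated by a map e, which is
   meant to be a bijection from {..<card (pverts D)} onto pverts D. *)
definition adjacency_mat :: "'a pair_pre_digraph \<Rightarrow> (nat \<Rightarrow> 'a) \<Rightarrow> real mat" where
  "adjacency_mat D e =
     mat (card (pverts D)) (card (pverts D)) (\<lambda>(i, j). if (e i, e j) \<in> parcs D then 1 else 0)"

definition normalised_adjacency_mat ::
  "('a, 'b) monoid_scheme \<Rightarrow> 'a set \<Rightarrow> (nat \<Rightarrow> 'a) \<Rightarrow> real mat" where
  "normalised_adjacency_mat G S e =
     (1 / real (card S)) \<cdot>\<^sub>m adjacency_mat (cayley_graph G S) e"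

definition normalised_laplacian ::
  "('a, 'b) monoid_scheme \<Rightarrow> 'a set \<Rightarrow> (nat \<Rightarrow> 'a) \<Rightarrow> real mat" where
  "normalised_laplacian G S e = 1\<^sub>m (card (carrier G)) - normalised_adjacency_mat G S e"

definition vertex_boundary :: "('a, 'b) monoid_scheme \<Rightarrow> 'a set \<Rightarrow> 'a set \<Rightarrow> 'a set" where
  "vertex_boundary G S X = (X <#>\<^bsub>G\<^esub> S) - X"

definition vertex_cheeger :: "('a, 'b) monoid_scheme \<Rightarrow> 'a set \<Rightarrow> real" where
  "vertex_cheeger G S =
     Min {real (card (vertex_boundary G S X)) / real (card X) | X.
            X \<noteq> {} \<and> X \<subseteq> carrier G \<and> real (card X) \<le> real (card (carrier G)) / 2}"

end

theory Submission
  imports Defs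
begin

text \<open>
  Write \<open>n = |G|\<close>, let \<open>2 - \<eta>\<close> be an eigenvalue of the Laplacian with eigenfunction \<open>f\<close>, and
  suppose that \<open>\<eta>\<close> is tiny. Then \<open>f(g) + f(gs)\<close> is small on average over the arcs, hence
  \<open>f\<^sup>2\<close> varies little along arcs, and the Cheeger constant (via a co-area argument) forces
  \<open>f\<^sup>2\<close> to be almost constant in the \<open>L\<^sup>1\<close> sense. Consequently only few arcs have both ends on
  the same side of \<open>A = {f > 0}\<close>.

  For \<open>x \<in> G\<close> the set of all \<open>g\<close> such that \<open>A\<close> contains both or neither of \<open>g\<close>, \<open>xg\<close> has few
  boundary arcs, since arcs are right multiplications and so commute with left translation by
  \<open>x\<close>. By expansion this set or its complement has less than \<open>n/3\<close> elements. The \<open>x\<close> for which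
  the complement is the small one form a subgroup \<open>K\<close> of index at most 2. If some \<open>s \<in> S\<close> were
  in \<open>K\<close>, then \<open>g\<close> and \<open>gs\<close> would lie in the same coset of the normal subgroup \<open>K\<close>, on which
  \<open>A\<close> is nearly constant, contradicting that most arcs cross between \<open>A\<close> and its complement.
  So \<open>S\<close> misses \<open>K\<close>, and \<open>K\<close> and its complement witness that the graph is bipartite.
\<close>

section \<open>Co-area principle on a finite set\<close>

text \<open>
  Co-area principle: induct on the number of values of \<open>\<phi>\<close>, lowering the top level to the second
  one; the difference is a multiple of the indicator of a cut.
\<close>

lemma sum_abs_diff_nonneg_of_cuts:
  fixes w :: "'a \<Rightarrow> 'a \<Rightarrow> real" and \<phi> :: "'a \<Rightarrow> real"
  assumes V: "finite V"
    and cuts: "\<And>X. X \<subseteq> V \<Longrightarrow> 0 \<le> (\<Sum>x\<in>V. \<Sum>y\<in>V. w x y * of_bool ((x \<in> X) \<noteq> (y \<in> X)))"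
  shows "0 \<le> (\<Sum>x\<in>V. \<Sum>y\<in>V. w x y * \<bar>\<phi> x - \<phi> y\<bar>)"
proof (induction "card (\<phi> ` V)" arbitrary: \<phi> rule: less_induct)
  case less
  show ?case
  proof (cases "\<exists>m. \<forall>x\<in>V. \<phi> x = m")
    case True
    then have "w x y * \<bar>\<phi> x - \<phi> y\<bar> = 0" if "x \<in> V" "y \<in> V" for x y
      using that by auto
    then show ?thesis by simp
  next
    case False
    define M where "M = Max (\<phi> ` V)"
    define X where "X = {x \<in> V. \<phi> x = M}"
    define M' where "M' = Max (\<phi> ` V - {M})"
    have ne: "V \<noteq> {}" using False by auto
    have M_in: "M \<in> \<phi> ` V" unfolding M_def using V ne by (intro Max_in) auto
    have "\<phi> ` V - {M} \<noteq> {}" using False by blast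
    then have M'_in: "M' \<in> \<phi> ` V - {M}" unfolding M'_def using V by (intro Max_in) auto
    have le_M: "\<phi> x \<le> M" if "x \<in> V" for x unfolding M_def using V that by auto
    have le_M': "\<phi> x \<le> M'" if "x \<in> V" "x \<notin> X" for x
      unfolding M'_def using V that by (intro Max_ge) (auto simp: X_def)
    have M'_less: "M' < M" using M'_in le_M by force
    define \<psi> where "\<psi> x = min (\<phi> x) M'" for x
    have "\<psi> ` V \<subseteq> \<phi> ` V - {M}"
      using M'_in M'_less le_M' by (auto simp: \<psi>_def min_def)
    then have "card (\<psi> ` V) < card (\<phi> ` V)"
      using V M_in by (intro psubset_card_mono) auto
    from less[OF this] have IH: "0 \<le> (\<Sum>x\<in>V. \<Sum>y\<in>V. w x y * \<bar>\<psi> x - \<psi> y\<bar>)" .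
    have split: "\<bar>\<phi> x - \<phi> y\<bar> = \<bar>\<psi> x - \<psi> y\<bar> + (M - M') * of_bool ((x \<in> X) \<noteq> (y \<in> X))"
      if "x \<in> V" "y \<in> V" for x y
      using that le_M[OF that(1)] le_M[OF that(2)] le_M'[of x] le_M'[of y] M'_less
      by (cases "x \<in> X"; cases "y \<in> X") (auto simp: \<psi>_def X_def min_def)
    have "(\<Sum>x\<in>V. \<Sum>y\<in>V. w x y * \<bar>\<phi> x - \<phi> y\<bar>)
      = (\<Sum>x\<in>V. \<Sum>y\<in>V. w x y * \<bar>\<psi> x - \<psi> y\<bar> + (M - M') * (w x y * of_bool ((x \<in> X) \<noteq> (y \<in> X))))"
      by (intro sum.cong refl) (simp only: split, simp add: algebra_simps)
    also have "\<dots> = (\<Sum>x\<in>V. \<Sum>y\<in>V. w x y * \<bar>\<psi> x - \<psi> y\<bar>)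
      + (M - M') * (\<Sum>x\<in>V. \<Sum>y\<in>V. w x y * of_bool ((x \<in> X) \<noteq> (y \<in> X)))"
      by (simp only: sum.distrib sum_distrib_left)
    also have "\<dots> \<ge> 0"
      using IH cuts[of X] M'_less by (intro add_nonneg_nonneg mult_nonneg_nonneg) (auto simp: X_def)
    finally show ?thesis .
  qed
qed

section \<open>Finite Cayley graphs and translation-invariant sums\<close>

locale finite_cayley = group G for G (structure) +
  fixes S :: "'a set"
  assumes finite_carrier: "finite (carrier G)"
    and S_subset: "S \<subseteq> carrier G"
    and S_inv: "s \<in> S \<Longrightarrow> inv s \<in> S"
    and generate_S: "generate G S = carrier G"
    and S_nonempty: "S \<noteq> {}"
    and one_notin_S: "\<one> \<notin> S"
begin

abbreviation "n \<equiv> real (card (carrier G))"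
abbreviation "h \<equiv> vertex_cheeger G S"

lemma finite_S: "finite S"
  using S_subset finite_carrier finite_subset by blast

lemma S_carrier: "s \<in> S \<Longrightarrow> s \<in> carrier G"
  using S_subset by blast

lemma n_pos: "0 < n"
  using finite_carrier one_closed by (auto simp: card_gt_0_iff)

lemma card_S_ge_1: "1 \<le> real (card S)"
  using finite_S S_nonempty by (simp add: Suc_le_eq card_gt_0_iff)

lemma n_ge_2: "2 \<le> n"
proof -
  obtain s where s: "s \<in> S" using S_nonempty by blast
  then have "card {\<one>, s} \<le> card (carrier G)"
    using finite_carrier S_carrier by (intro card_mono) auto
  moreover have "\<one> \<noteq> s" using s one_notin_S by blast
  then have "card {\<one>, s} = 2" by simp
  ultimately show ?thesis by simp
qed

lemma sum_right_translate:
  assumes "s \<in> carrier G"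
  shows "(\<Sum>g\<in>carrier G. F (g \<otimes> s)) = (\<Sum>g\<in>carrier G. F g)"
  by (rule sum.reindex_bij_witness[where i = "\<lambda>g. g \<otimes> inv s" and j = "\<lambda>g. g \<otimes> s"])
    (use assms in \<open>auto simp: m_assoc\<close>)

lemma sum_left_translate:
  assumes "x \<in> carrier G"
  shows "(\<Sum>g\<in>carrier G. F (x \<otimes> g)) = (\<Sum>g\<in>carrier G. F g)"
  by (rule sum.reindex_bij_witness[where i = "\<lambda>g. inv x \<otimes> g" and j = "\<lambda>g. x \<otimes> g"])
    (use assms in \<open>auto simp: m_assoc[symmetric]\<close>)

lemma sum_inv_S: "(\<Sum>s\<in>S. F (inv s)) = (\<Sum>s\<in>S. F s)"
  by (rule sum.reindex_bij_witness[where i = "\<lambda>s. inv s" and j = "\<lambda>s. inv s"])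
    (auto simp: S_inv S_carrier)

section \<open>Connectivity and the vertex Cheeger constant\<close>

abbreviation "cheeger_quotients \<equiv> {real (card (vertex_boundary G S X)) / real (card X) | X.
            X \<noteq> {} \<and> X \<subseteq> carrier G \<and> real (card X) \<le> real (card (carrier G)) / 2}"

lemma finite_cheeger_quotients: "finite cheeger_quotients"
  by (rule finite_subset[of _ "(\<lambda>X. real (card (vertex_boundary G S X)) / real (card X)) ` Pow (carrier G)"])
    (auto simp: finite_carrier)

lemma cheeger_le:
  assumes "X \<subseteq> carrier G" "real (card X) \<le> n / 2"
  shows "h * real (card X) \<le> real (card (vertex_boundary G S X))"
proof (cases "X = {}")
  case False
  then have "0 < real (card X)"
    using assms finite_carrier finite_subset by (fastforce simp: card_gt_0_iff)
  moreover have "h \<le> real (card (vertex_boundary G S X)) / real (card X)"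
    unfolding vertex_cheeger_def using assms False
    by (intro Min_le finite_cheeger_quotients) auto
  ultimately show ?thesis by (simp add: field_simps)
qed simp

text \<open>This is connectivity of the Cayley graph: a walk spelling
  \<open>inv x \<otimes> g\<close> leads from \<open>x\<close> to \<open>g\<close>. Inverse letters
  cause no trouble because \<open>S\<close> is symmetric.\<close>

lemma right_S_stable_eq_carrier:
  assumes X: "X \<subseteq> carrier G" "X \<noteq> {}" and stable: "\<And>x s. x \<in> X \<Longrightarrow> s \<in> S \<Longrightarrow> x \<otimes> s \<in> X"
  shows "X = carrier G"
proof -
  have step: "x \<otimes> y \<in> X" if "y \<in> generate G S" "x \<in> X" for x y
    using that
  proof (induction arbitrary: x rule: generate.induct)
    case (eng h1 h2)
    then have "x \<otimes> (h1 \<otimes> h2) = (x \<otimes> h1) \<otimes> h2"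
      using X generate_S by (intro m_assoc[symmetric]) auto
    then show ?case using eng by simp
  qed (use X stable S_inv in auto)
  obtain x where x: "x \<in> X" using X by blast
  have "g \<in> X" if "g \<in> carrier G" for g
  proof -
    have "x \<otimes> (inv x \<otimes> g) \<in> X" using x X that by (intro step) (auto simp: generate_S)
    moreover have "x \<otimes> (inv x \<otimes> g) = g" using x X that by (auto simp: m_assoc[symmetric])
    ultimately show ?thesis by simp
  qed
  then show ?thesis using X by blast
qed

lemma cheeger_attained:
  obtains X where "X \<noteq> {}" "X \<subseteq> carrier G" "real (card X) \<le> n / 2"
    "h = real (card (vertex_boundary G S X)) / real (card X)"
proof -
  \<comment> \<open>A singleton is admissible because a non-identity generator forces
    \<open>n\<close> to be at least 2. Without an admissible set, \<open>Min\<close> would be an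
    unspecified value.\<close>
  have "{\<one>} \<noteq> {} \<and> {\<one>} \<subseteq> carrier G \<and> real (card {\<one>}) \<le> n / 2" using n_ge_2 by auto
  then have "cheeger_quotients \<noteq> {}" by blast
  then have "h \<in> cheeger_quotients"
    unfolding vertex_cheeger_def by (intro Min_in finite_cheeger_quotients)
  then show ?thesis using that by blast
qed

text \<open>A minimising set with empty boundary would be closed under right multiplication by
  \<open>S\<close>, hence the whole group, which is too large to be admissible.\<close>

lemma cheeger_pos: "0 < h"
proof -
  obtain X where X: "X \<noteq> {}" "X \<subseteq> carrier G" "real (card X) \<le> n / 2"
    "h = real (card (vertex_boundary G S X)) / real (card X)"
    by (rule cheeger_attained)
  have finX: "finite X" using X finite_carrier finite_subset by blast
  have finB: "finite (vertex_boundary G S X)"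
    using finX finite_S by (auto simp: vertex_boundary_def set_mult_def)
  have "vertex_boundary G S X \<noteq> {}"
  proof
    assume "vertex_boundary G S X = {}"
    then have "X = carrier G"
      by (intro right_S_stable_eq_carrier X) (auto simp: vertex_boundary_def set_mult_def)
    then show False using X n_pos by simp
  qed
  then show ?thesis using X finX finB by (simp add: card_gt_0_iff)
qed

text \<open>The test set is the identity alone. The bound later trades powers of \<open>h\<close>
  for powers of the degree.\<close>

lemma cheeger_le_card_S: "h \<le> real (card S)"
proof -
  have "h \<le> real (card (vertex_boundary G S {\<one>}))"
    using cheeger_le[of "{\<one>}"] n_ge_2 by simp
  also have "vertex_boundary G S {\<one>} \<subseteq> S"
    using S_carrier by (auto simp: vertex_boundary_def set_mult_def)
  then have "card (vertex_boundary G S {\<one>}) \<le> card S" by (intro card_mono finite_S)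
  finally show ?thesis by simp
qed

section \<open>Edge cuts and the Cheeger inequality in L1 form\<close>

text \<open>Each undirected edge is counted from both of its ends, so this is twice the usual edge
  boundary.\<close>

definition cut :: "'a set \<Rightarrow> real" where
  "cut X = (\<Sum>g\<in>carrier G. \<Sum>s\<in>S. of_bool ((g \<in> X) \<noteq> (g \<otimes> s \<in> X)))"

text \<open>Reversing arcs, \<open>(g, s)\<close> to \<open>(g \<otimes> s, inv s)\<close>,
  exchanges the arcs entering \<open>X\<close> with those leaving it.\<close>

lemma cut_eq_twice_out:
  "cut X = 2 * (\<Sum>g\<in>carrier G. \<Sum>s\<in>S. of_bool (g \<in> X \<and> g \<otimes> s \<notin> X))"
proof -
  have "(\<Sum>g\<in>carrier G. \<Sum>s\<in>S. of_bool (g \<notin> X \<and> g \<otimes> s \<in> X))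
    = (\<Sum>s\<in>S. \<Sum>g\<in>carrier G. of_bool (g \<notin> X \<and> g \<otimes> s \<in> X) :: real)"
    by (rule sum.swap)
  also have "\<dots> = (\<Sum>s\<in>S. \<Sum>g\<in>carrier G. of_bool (g \<otimes> inv s \<notin> X \<and> g \<otimes> inv s \<otimes> s \<in> X))"
    by (intro sum.cong refl sum_right_translate[symmetric]) (simp add: S_carrier)
  also have "\<dots> = (\<Sum>s\<in>S. \<Sum>g\<in>carrier G. of_bool (g \<otimes> inv s \<notin> X \<and> g \<in> X))"
    by (intro sum.cong refl) (simp add: S_carrier m_assoc)
  also have "\<dots> = (\<Sum>s\<in>S. \<Sum>g\<in>carrier G. of_bool (g \<otimes> s \<notin> X \<and> g \<in> X))"
    by (rule sum_inv_S)
  also have "\<dots> = (\<Sum>g\<in>carrier G. \<Sum>s\<in>S. of_bool (g \<in> X \<and> g \<otimes> s \<notin> X))"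
    by (subst sum.swap) (simp add: conj_commute)
  finally have sym: "(\<Sum>g\<in>carrier G. \<Sum>s\<in>S. of_bool (g \<notin> X \<and> g \<otimes> s \<in> X))
    = (\<Sum>g\<in>carrier G. \<Sum>s\<in>S. of_bool (g \<in> X \<and> g \<otimes> s \<notin> X) :: real)" .
  have "cut X = (\<Sum>g\<in>carrier G. \<Sum>s\<in>S. of_bool (g \<in> X \<and> g \<otimes> s \<notin> X) + of_bool (g \<notin> X \<and> g \<otimes> s \<in> X))"
    unfolding cut_def by (intro sum.cong refl) auto
  then show ?thesis by (simp add: sum.distrib sym)
qed

lemma cut_compl: "cut (carrier G - X) = cut X"
  unfolding cut_def by (intro sum.cong refl) (auto simp: S_carrier)

text \<open>Every boundary vertex is the head of at least one arc leaving \<open>X\<close>, so the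
  vertex boundary is no larger than the set \<open>E\<close> of these arcs.\<close>

lemma cut_ge_small:
  assumes "X \<subseteq> carrier G" "real (card X) \<le> n / 2"
  shows "2 * h * real (card X) \<le> cut X"
proof -
  define E where "E = {p \<in> carrier G \<times> S. fst p \<in> X \<and> fst p \<otimes> snd p \<notin> X}"
  have finE: "finite E" using finite_carrier finite_S by (auto simp: E_def)
  have "vertex_boundary G S X \<subseteq> (\<lambda>p. fst p \<otimes> snd p) ` E"
    using assms(1) by (force simp: vertex_boundary_def set_mult_def E_def)
  then have "card (vertex_boundary G S X) \<le> card E"
    using surj_card_le[OF finE] by blast
  also have "real (card E) = (\<Sum>p\<in>carrier G \<times> S. of_bool (fst p \<in> X \<and> fst p \<otimes> snd p \<notin> X))"
    using finite_carrier finite_S by (simp add: E_def sum_of_bool_eq Int_def)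
  also have "\<dots> = (\<Sum>g\<in>carrier G. \<Sum>s\<in>S. of_bool (g \<in> X \<and> g \<otimes> s \<notin> X))"
    by (simp add: sum.cartesian_product case_prod_beta)
  also have "\<dots> = cut X / 2" by (simp add: cut_eq_twice_out)
  finally show ?thesis using cheeger_le[OF assms] by simp
qed

lemma cut_ge_min:
  assumes "X \<subseteq> carrier G"
  shows "2 * h * min (real (card X)) (n - real (card X)) \<le> cut X"
proof (cases "real (card X) \<le> n / 2")
  case True
  then show ?thesis using cut_ge_small[OF assms True] by (simp add: min_def)
next
  case False
  have "real (card (carrier G - X)) = n - real (card X)"
    using assms finite_carrier by (simp add: card_Diff_subset card_mono finite_subset of_nat_diff)
  then show ?thesis
    using False cut_ge_small[of "carrier G - X"] by (simp add: cut_compl min_def)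
qed


lemma sum_card_indicator:
  assumes "X \<subseteq> carrier G"
  shows "(\<Sum>g\<in>carrier G. of_bool (g \<in> X)) = real (card X)"
  using assms finite_carrier by (simp add: sum_of_bool_eq Int_absorb1)

text \<open>Passes from an adjacency kernel on pairs of vertices to a sum over generators. It serves
  both the co-area weight and the matrix-vector product.\<close>

lemma sum_neighbours:
  assumes "g \<in> carrier G"
  shows "(\<Sum>y\<in>carrier G. (\<Sum>s\<in>S. of_bool (y = g \<otimes> s)) * F y) = (\<Sum>s\<in>S. F (g \<otimes> s) :: real)"
proof -
  have "(\<Sum>y\<in>carrier G. (\<Sum>s\<in>S. of_bool (y = g \<otimes> s)) * F y)
    = (\<Sum>s\<in>S. \<Sum>y\<in>carrier G. of_bool (y = g \<otimes> s) * F y)"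
    by (subst sum.swap) (simp add: sum_distrib_right)
  also have "\<dots> = (\<Sum>s\<in>S. F (g \<otimes> s))"
  proof (intro sum.cong refl)
    fix s assume "s \<in> S"
    then have "g \<otimes> s \<in> carrier G" using assms S_carrier by auto
    moreover have "(\<Sum>y\<in>carrier G. of_bool (y = g \<otimes> s) * F y)
      = (\<Sum>y\<in>carrier G. if y = g \<otimes> s then F y else 0)"
      by (intro sum.cong) auto
    ultimately show "(\<Sum>y\<in>carrier G. of_bool (y = g \<otimes> s) * F y) = F (g \<otimes> s)"
      using finite_carrier by simp
  qed
  finally show ?thesis .
qed

text \<open>The difference of the two sides is linear in the terms
  \<open>\<bar>\<phi> x - \<phi> y\<bar>\<close>, with weight \<open>w\<close>. By the co-area
  principle only indicators of sets need checking, and there it is the expansion bound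
  \<open>cut_ge_min\<close>.\<close>

lemma cheeger_L1_pairs:
  "h * (\<Sum>x\<in>carrier G. \<Sum>y\<in>carrier G. \<bar>\<phi> x - \<phi> y\<bar>)
    \<le> n * (\<Sum>g\<in>carrier G. \<Sum>s\<in>S. \<bar>\<phi> g - \<phi> (g \<otimes> s) :: real\<bar>)"
proof -
  define w where "w x y = n * (\<Sum>s\<in>S. of_bool (y = x \<otimes> s)) - h" for x y
  have w_sum: "(\<Sum>x\<in>carrier G. \<Sum>y\<in>carrier G. w x y * F x y)
    = n * (\<Sum>g\<in>carrier G. \<Sum>s\<in>S. F g (g \<otimes> s)) - h * (\<Sum>x\<in>carrier G. \<Sum>y\<in>carrier G. F x y)"
    for F :: "'a \<Rightarrow> 'a \<Rightarrow> real"
  proof -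
    have "(\<Sum>x\<in>carrier G. \<Sum>y\<in>carrier G. w x y * F x y)
      = (\<Sum>x\<in>carrier G. n * (\<Sum>y\<in>carrier G. (\<Sum>s\<in>S. of_bool (y = x \<otimes> s)) * F x y)
          - h * (\<Sum>y\<in>carrier G. F x y))"
      by (simp only: w_def left_diff_distrib sum_subtractf mult.assoc sum_distrib_left[symmetric])
    also have "\<dots> = (\<Sum>x\<in>carrier G. n * (\<Sum>s\<in>S. F x (x \<otimes> s)) - h * (\<Sum>y\<in>carrier G. F x y))"
      by (intro sum.cong refl) (simp only: sum_neighbours)
    also have "\<dots> = n * (\<Sum>g\<in>carrier G. \<Sum>s\<in>S. F g (g \<otimes> s))
        - h * (\<Sum>x\<in>carrier G. \<Sum>y\<in>carrier G. F x y)"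
      by (simp only: sum_subtractf sum_distrib_left)
    finally show ?thesis .
  qed
  have "0 \<le> (\<Sum>x\<in>carrier G. \<Sum>y\<in>carrier G. w x y * \<bar>\<phi> x - \<phi> y\<bar>)"
  proof (rule sum_abs_diff_nonneg_of_cuts[OF finite_carrier])
    fix X assume X: "X \<subseteq> carrier G"
    define a where "a = real (card X)"
    have a: "0 \<le> a" "a \<le> n" using X finite_carrier by (auto simp: a_def card_mono)
    have ind: "of_bool (p \<noteq> q) = of_bool p + of_bool q - 2 * of_bool p * (of_bool q :: real)" for p q
      by auto
    have "(\<Sum>x\<in>carrier G. \<Sum>y\<in>carrier G. of_bool ((x \<in> X) \<noteq> (y \<in> X)))
      = (\<Sum>x\<in>carrier G. n * of_bool (x \<in> X) + a - 2 * of_bool (x \<in> X) * a)"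
      by (intro sum.cong refl)
        (simp only: ind sum.distrib sum_subtractf sum_distrib_left[symmetric] sum_card_indicator[OF X] a_def
           sum_constant)
    also have "\<dots> = n * a + n * a - 2 * a * a"
      by (simp only: sum.distrib sum_subtractf sum_distrib_left[symmetric] sum_distrib_right[symmetric]
          sum_card_indicator[OF X] a_def[symmetric] sum_constant)
    finally have pairs: "(\<Sum>x\<in>carrier G. \<Sum>y\<in>carrier G. of_bool ((x \<in> X) \<noteq> (y \<in> X))) = 2 * (a * (n - a))"
      by (simp add: algebra_simps)
    \<comment> \<open>The product is the minimum times the maximum of the two factors, and the
      maximum is at most \<open>n\<close>.\<close>
    have "a * (n - a) \<le> n * min a (n - a)"
      using a by (cases "a \<le> n - a") (auto simp: min_def mult_right_mono mult_left_mono mult.commute)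
    then have "h * (2 * (a * (n - a))) \<le> h * (2 * (n * min a (n - a)))"
      using cheeger_pos by simp
    also have "\<dots> \<le> n * cut X"
      using mult_left_mono[OF cut_ge_min[OF X], of n] n_pos by (simp add: a_def mult_ac)
    finally show "0 \<le> (\<Sum>x\<in>carrier G. \<Sum>y\<in>carrier G. w x y * of_bool ((x \<in> X) \<noteq> (y \<in> X)))"
      unfolding w_sum pairs cut_def by simp
  qed
  then show ?thesis unfolding w_sum by simp
qed

text \<open>By the triangle inequality the distance from a value to the mean is at most its average
  distance to all values, which reduces this to the bound over pairs.\<close>

lemma cheeger_L1_mean:
  fixes \<phi> :: "'a \<Rightarrow> real"
  assumes m: "(\<Sum>g\<in>carrier G. \<phi> g) = n * m"
  shows "h * (\<Sum>g\<in>carrier G. \<bar>\<phi> g - m\<bar>) \<le> (\<Sum>g\<in>carrier G. \<Sum>s\<in>S. \<bar>\<phi> g - \<phi> (g \<otimes> s)\<bar>)"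
proof -
  have "n * \<bar>\<phi> x - m\<bar> \<le> (\<Sum>y\<in>carrier G. \<bar>\<phi> x - \<phi> y\<bar>)" for x
  proof -
    have "n * \<bar>\<phi> x - m\<bar> = \<bar>\<Sum>y\<in>carrier G. \<phi> x - \<phi> y\<bar>"
      using m n_pos abs_mult[of n "\<phi> x - m"] by (simp add: sum_subtractf right_diff_distrib)
    then show ?thesis by (simp only: sum_abs)
  qed
  then have "n * (\<Sum>g\<in>carrier G. \<bar>\<phi> g - m\<bar>) \<le> (\<Sum>x\<in>carrier G. \<Sum>y\<in>carrier G. \<bar>\<phi> x - \<phi> y\<bar>)"
    unfolding sum_distrib_left by (intro sum_mono)
  then have "h * (n * (\<Sum>g\<in>carrier G. \<bar>\<phi> g - m\<bar>))
      \<le> h * (\<Sum>x\<in>carrier G. \<Sum>y\<in>carrier G. \<bar>\<phi> x - \<phi> y\<bar>)"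
    using cheeger_pos by (intro mult_left_mono) auto
  also note cheeger_L1_pairs
  finally have "n * (h * (\<Sum>g\<in>carrier G. \<bar>\<phi> g - m\<bar>))
      \<le> n * (\<Sum>g\<in>carrier G. \<Sum>s\<in>S. \<bar>\<phi> g - \<phi> (g \<otimes> s)\<bar>)"
    by (simp only: mult.left_commute)
  then show ?thesis using n_pos by simp
qed

section \<open>The sign set of an eigenfunction\<close>

text \<open>Measures how far \<open>A\<close> and its complement are from a bipartition: it vanishes
  exactly when they are one.\<close>

definition mono_arcs :: "'a set \<Rightarrow> real" where
  "mono_arcs A = (\<Sum>g\<in>carrier G. \<Sum>s\<in>S. of_bool ((g \<in> A) = (g \<otimes> s \<in> A)))"

text \<open>The hypothesis \<open>eig\<close> says that \<open>f\<close> has Laplacian eigenvalue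
  \<open>2 - \<eta>\<close>. An arc within one side costs at least \<open>(f g)\<^sup>2\<close> in
  the sum of \<open>(f g + f (g \<otimes> s))\<^sup>2\<close>, which is small for small
  \<open>\<eta>\<close>, while \<open>(f g)\<^sup>2\<close> is close to its mean.\<close>

lemma sign_set_mono_arcs:
  fixes f :: "'a \<Rightarrow> real"
  assumes eig: "\<And>g. g \<in> carrier G \<Longrightarrow> (\<Sum>s\<in>S. f (g \<otimes> s)) = real (card S) * (\<eta> - 1) * f g"
    and nz: "g0 \<in> carrier G" "f g0 \<noteq> 0"
    and \<eta>: "\<eta> \<le> h ^ 4 / (2 ^ 9 * real (card S) ^ 8)"
  shows "mono_arcs {g. 0 < f g} \<le> 33 / 256 * n * (h / real (card S) ^ 2)"
proof -
  define d where "d = real (card S)"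
  have d: "1 \<le> d" using card_S_ge_1 by (simp add: d_def)
  define N where "N = (\<Sum>g\<in>carrier G. (f g)\<^sup>2)"
  have "0 < N" unfolding N_def using nz finite_carrier
    by (intro sum_pos2[of _ g0]) auto
  \<comment> \<open>With this choice the hypothesis reads \<open>\<eta> \<le> q\<^sup>2 / 2\<close>,
    and the bound \<open>h * L \<le> 2 * d * q * N\<close> reached below becomes
    \<open>L \<le> h * N / (8 * d ^ 3)\<close>.\<close>
  define q where "q = h\<^sup>2 / (16 * d ^ 4)"
  have q: "0 < q" using cheeger_pos d by (simp add: q_def)
  have \<eta>q: "\<eta> \<le> q\<^sup>2 / 2" using \<eta> by (simp add: q_def d_def power_divide power_mult_distrib flip: power_mult)
  have shift: "(\<Sum>g\<in>carrier G. \<Sum>s\<in>S. (f (g \<otimes> s))\<^sup>2) = d * N"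
  proof -
    have "(\<Sum>g\<in>carrier G. \<Sum>s\<in>S. (f (g \<otimes> s))\<^sup>2) = (\<Sum>s\<in>S. \<Sum>g\<in>carrier G. (f (g \<otimes> s))\<^sup>2)"
      by (rule sum.swap)
    also have "\<dots> = (\<Sum>s\<in>S. N)"
      unfolding N_def by (intro sum.cong refl sum_right_translate S_carrier)
    finally show ?thesis by (simp add: d_def)
  qed
  have base: "(\<Sum>g\<in>carrier G. \<Sum>s\<in>S. (f g)\<^sup>2) = d * N"
    by (simp add: N_def d_def sum_distrib_left)
  have cross: "(\<Sum>g\<in>carrier G. f g * (\<Sum>s\<in>S. f (g \<otimes> s))) = d * (\<eta> - 1) * N"
  proof -
    have "(\<Sum>g\<in>carrier G. f g * (\<Sum>s\<in>S. f (g \<otimes> s))) = (\<Sum>g\<in>carrier G. d * (\<eta> - 1) * (f g)\<^sup>2)"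
      by (intro sum.cong refl) (simp add: eig d_def power2_eq_square)
    then show ?thesis by (simp add: N_def sum_distrib_left)
  qed
  define P where "P = (\<Sum>g\<in>carrier G. \<Sum>s\<in>S. (f g + f (g \<otimes> s))\<^sup>2)"
  define R where "R = (\<Sum>g\<in>carrier G. \<Sum>s\<in>S. (f g - f (g \<otimes> s))\<^sup>2)"
  \<comment> \<open>Expanding the square, the diagonal terms give \<open>2 * d * N\<close> and the
    cross term cancels all of it but the part carrying \<open>\<eta>\<close>.\<close>
  have P: "P = 2 * d * \<eta> * N"
  proof -
    have "P = (\<Sum>g\<in>carrier G. \<Sum>s\<in>S. (f g)\<^sup>2 + (f (g \<otimes> s))\<^sup>2 + 2 * (f g * f (g \<otimes> s)))"
      unfolding P_def by (simp add: power2_sum mult.assoc)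
    also have "\<dots> = d * N + d * N + 2 * (d * (\<eta> - 1) * N)"
      by (simp only: sum.distrib sum_distrib_left[symmetric] base shift cross)
    finally show ?thesis by (simp add: algebra_simps)
  qed
  have R: "R \<le> 4 * d * N"
  proof -
    have "R \<le> (\<Sum>g\<in>carrier G. \<Sum>s\<in>S. 2 * (f g)\<^sup>2 + 2 * (f (g \<otimes> s))\<^sup>2)"
      unfolding R_def
    proof (intro sum_mono)
      fix g s
      have "0 \<le> (f g + f (g \<otimes> s))\<^sup>2" by simp
      then show "(f g - f (g \<otimes> s))\<^sup>2 \<le> 2 * (f g)\<^sup>2 + 2 * (f (g \<otimes> s))\<^sup>2"
        by (simp add: power2_sum power2_diff)
    qed
    also have "\<dots> = 2 * (d * N) + 2 * (d * N)"
      by (simp only: sum.distrib sum_distrib_left[symmetric] base shift)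
    finally show ?thesis by (simp add: mult_ac)
  qed
  \<comment> \<open>AM-GM for \<open>|a\<^sup>2 - b\<^sup>2| = |a + b| |a - b|\<close>, with the weight \<open>q\<close> that balances \<open>P \<le> d q\<^sup>2 N\<close> against \<open>R \<le> 4 d N\<close>.\<close>
  have am_gm: "\<bar>a\<^sup>2 - b\<^sup>2\<bar> \<le> (a + b)\<^sup>2 / q + q / 4 * (a - b)\<^sup>2" for a b :: real
  proof -
    have "0 \<le> (\<bar>a + b\<bar> - q / 2 * \<bar>a - b\<bar>)\<^sup>2 / q" using q by simp
    also have "\<dots> = (a + b)\<^sup>2 / q + q / 4 * (a - b)\<^sup>2 - \<bar>a + b\<bar> * \<bar>a - b\<bar>"
      using q by (simp add: power2_diff power_mult_distrib power_divide field_simps power2_eq_square[of q])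
    also have "\<bar>a + b\<bar> * \<bar>a - b\<bar> = \<bar>a\<^sup>2 - b\<^sup>2\<bar>"
      by (simp add: abs_mult[symmetric] power2_eq_square algebra_simps)
    finally show ?thesis by simp
  qed
  define Q where "Q = N / n"
  have Q: "0 < Q" using \<open>0 < N\<close> n_pos by (simp add: Q_def)
  define L where "L = (\<Sum>g\<in>carrier G. \<bar>(f g)\<^sup>2 - Q\<bar>)"
  have "h * L \<le> (\<Sum>g\<in>carrier G. \<Sum>s\<in>S. \<bar>(f g)\<^sup>2 - (f (g \<otimes> s))\<^sup>2\<bar>)"
    unfolding L_def using n_pos by (intro cheeger_L1_mean) (simp add: Q_def N_def)
  also have "\<dots> \<le> (\<Sum>g\<in>carrier G. \<Sum>s\<in>S. (f g + f (g \<otimes> s))\<^sup>2 / q + q / 4 * (f g - f (g \<otimes> s))\<^sup>2)"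
    by (intro sum_mono am_gm)
  also have "\<dots> = P / q + q / 4 * R"
    by (simp only: P_def R_def sum.distrib sum_distrib_left[symmetric] sum_divide_distrib[symmetric])
  also have "\<dots> \<le> 2 * d * (q\<^sup>2 / 2) * N / q + q / 4 * (4 * d * N)"
    unfolding P using R \<eta>q d q \<open>0 < N\<close>
    by (intro add_mono divide_right_mono mult_left_mono mult_right_mono) auto
  also have "\<dots> = h * (h * N / (8 * d ^ 3))"
    using d q by (simp add: power2_eq_square) (simp add: q_def field_simps eval_nat_numeral)
  finally have L: "L \<le> h * N / (8 * d ^ 3)" by (simp only: mult_le_cancel_left_pos[OF cheeger_pos])
  \<comment> \<open>If both ends have the same sign, the product of their values is nonnegative, so
    \<open>(f g + f (g \<otimes> s))\<^sup>2\<close> is at least \<open>(f g)\<^sup>2\<close>, hence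
    at least \<open>Q - \<bar>(f g)\<^sup>2 - Q\<bar>\<close>.\<close>
  have "Q * mono_arcs {g. 0 < f g} \<le> (\<Sum>g\<in>carrier G. \<Sum>s\<in>S. (f g + f (g \<otimes> s))\<^sup>2 + \<bar>(f g)\<^sup>2 - Q\<bar>)"
    unfolding mono_arcs_def sum_distrib_left
  proof (intro sum_mono)
    fix g s
    show "Q * of_bool ((g \<in> {g. 0 < f g}) = (g \<otimes> s \<in> {g. 0 < f g}))
      \<le> (f g + f (g \<otimes> s))\<^sup>2 + \<bar>(f g)\<^sup>2 - Q\<bar>"
    proof (cases "(0 < f g) = (0 < f (g \<otimes> s))")
      case True
      then have "0 \<le> f g * f (g \<otimes> s)" by (cases "0 < f g") (auto simp: mult_nonpos_nonpos)
      moreover have "0 \<le> (f (g \<otimes> s))\<^sup>2" by simp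
      ultimately have "(f g)\<^sup>2 \<le> (f g + f (g \<otimes> s))\<^sup>2" by (simp add: power2_sum)
      then show ?thesis using True by simp
    qed simp
  qed
  also have "\<dots> = P + d * L"
    by (simp add: sum.distrib P_def L_def d_def sum_distrib_left)
  \<comment> \<open>The constant 33/256 is 1/256 from \<open>P\<close> plus 32/256 from
    \<open>d * L\<close>. For \<open>P\<close>, three of the four factors \<open>h\<close> are
    absorbed through \<open>h \<le> d\<close>.\<close>
  also have "\<dots> \<le> N * (h / (256 * d ^ 2)) + N * (h / (8 * d ^ 2))"
  proof (intro add_mono)
    have "h ^ 3 \<le> d ^ 3" using cheeger_le_card_S cheeger_pos by (intro power_mono) (auto simp: d_def)
    also have "\<dots> \<le> d ^ 5" using d by (intro power_increasing) auto
    finally have "h * h ^ 3 / d ^ 7 \<le> h * d ^ 5 / d ^ 7"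
      using cheeger_pos d by (intro divide_right_mono mult_left_mono) auto
    then have "h ^ 4 / d ^ 7 \<le> h / d ^ 2" using d by (simp add: eval_nat_numeral field_simps)
    moreover have "P \<le> 2 * d * (q\<^sup>2 / 2) * N"
      unfolding P using \<eta>q d \<open>0 < N\<close> by (intro mult_left_mono mult_right_mono) auto
    moreover have "2 * d * (q\<^sup>2 / 2) * N = N * (h ^ 4 / d ^ 7) / 256"
      using d by (simp add: q_def field_simps eval_nat_numeral)
    ultimately show "P \<le> N * (h / (256 * d ^ 2))"
      using mult_left_mono[of "h ^ 4 / d ^ 7" "h / d ^ 2" N] \<open>0 < N\<close> by simp
    have "d * L \<le> d * (h * N / (8 * d ^ 3))" using L d by (intro mult_left_mono) auto
    also have "\<dots> = N * (h / (8 * d ^ 2))" using d by (simp add: field_simps eval_nat_numeral)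
    finally show "d * L \<le> N * (h / (8 * d ^ 2))" .
  qed
  also have "\<dots> = Q * (33 / 256 * n * (h / d ^ 2))"
    using n_pos d by (simp add: Q_def field_simps)
  finally show ?thesis unfolding mult_le_cancel_left_pos[OF Q] d_def .
qed

section \<open>Left translates of a near-bipartition and the subgroup of index at most two\<close>

text \<open>Within the group, this is the size of the symmetric difference of \<open>A\<close> and
  its translate by \<open>inv x\<close>. \<open>A\<close> may contain elements outside the carrier,
  as a sign set can.\<close>

definition disagree :: "'a set \<Rightarrow> 'a \<Rightarrow> real" where
  "disagree A x = (\<Sum>g\<in>carrier G. of_bool ((g \<in> A) \<noteq> (x \<otimes> g \<in> A)))"

definition agree :: "'a set \<Rightarrow> 'a \<Rightarrow> real" where
  "agree A x = (\<Sum>g\<in>carrier G. of_bool ((g \<in> A) = (x \<otimes> g \<in> A)))"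

lemma agree_plus_disagree: "agree A x + disagree A x = n"
proof -
  have "of_bool (p = q) + of_bool (p \<noteq> q) = (1 :: real)" for p q :: bool by simp
  then show ?thesis
    unfolding agree_def disagree_def sum.distrib[symmetric] by (simp only: sum_constant mult_1_right)
qed

text \<open>If the arcs from \<open>g\<close> to \<open>g \<otimes> s\<close> and from
  \<open>x \<otimes> g\<close> to \<open>x \<otimes> g \<otimes> s\<close> both cross between the
  sides, agreement is the same at \<open>g\<close> and \<open>g \<otimes> s\<close>. So each
  boundary arc of \<open>X\<close> uses up an arc within a side, and \<open>cut X\<close> is at most
  twice \<open>mono_arcs A\<close>.\<close>

lemma agree_or_disagree_small:
  assumes x: "x \<in> carrier G" and A: "3 * mono_arcs A < n * h"
  shows "3 * agree A x < n \<or> 3 * disagree A x < n"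
proof -
  define X where "X = {g \<in> carrier G. (g \<in> A) = (x \<otimes> g \<in> A)}"
  have X_carrier: "X \<subseteq> carrier G" by (auto simp: X_def)
  have disagree_eq: "disagree A x = n - agree A x" using agree_plus_disagree[of A x] by simp
  have card_X: "real (card X) = agree A x"
    unfolding agree_def X_def using finite_carrier by (simp add: sum_of_bool_eq Int_def)
  have "cut X \<le> (\<Sum>g\<in>carrier G. \<Sum>s\<in>S. of_bool ((g \<in> A) = (g \<otimes> s \<in> A))
      + of_bool ((x \<otimes> g \<in> A) = (x \<otimes> g \<otimes> s \<in> A)))"
    unfolding cut_def
    by (intro sum_mono) (use x in \<open>auto simp: X_def S_carrier m_assoc of_bool_def\<close>)
  also have "\<dots> = mono_arcs A + mono_arcs A"
    using sum_left_translate[OF x, of "\<lambda>g. \<Sum>s\<in>S. of_bool ((g \<in> A) = (g \<otimes> s \<in> A))"]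
    by (simp add: sum.distrib mono_arcs_def)
  finally have "h * min (agree A x) (disagree A x) \<le> mono_arcs A"
    using cut_ge_min[OF X_carrier] disagree_eq by (simp add: card_X)
  with A have "h * (3 * min (agree A x) (disagree A x)) < h * n" by (simp add: mult_ac)
  then show ?thesis using cheeger_pos by (auto simp: min_def split: if_splits)
qed

text \<open>Pointwise this is parity: comparing \<open>g\<close> with \<open>y \<otimes> g\<close>
  and then with \<open>x \<otimes> (y \<otimes> g)\<close> determines how \<open>g\<close> compares
  with the last.\<close>

lemma disagree_translate:
  assumes "x \<in> carrier G" "y \<in> carrier G"
  shows "disagree A (x \<otimes> y) \<le> disagree A x + disagree A y"
    and "disagree A (x \<otimes> y) \<le> agree A x + agree A y"
    and "agree A (x \<otimes> y) \<le> disagree A x + agree A y"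
    and "agree A (x \<otimes> y) \<le> agree A x + disagree A y"
proof -
  have D: "disagree A x = (\<Sum>g\<in>carrier G. of_bool ((y \<otimes> g \<in> A) \<noteq> (x \<otimes> (y \<otimes> g) \<in> A)))"
    unfolding disagree_def by (rule sum_left_translate[symmetric]) fact
  have E: "agree A x = (\<Sum>g\<in>carrier G. of_bool ((y \<otimes> g \<in> A) = (x \<otimes> (y \<otimes> g) \<in> A)))"
    unfolding agree_def by (rule sum_left_translate[symmetric]) fact
  note * = D E disagree_def[of A y] disagree_def[of A "x \<otimes> y"] agree_def[of A y]
    agree_def[of A "x \<otimes> y"] sum.distrib[symmetric]
  show "disagree A (x \<otimes> y) \<le> disagree A x + disagree A y"
    unfolding * by (intro sum_mono) (use assms in \<open>auto simp: m_assoc of_bool_def\<close>)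
  show "disagree A (x \<otimes> y) \<le> agree A x + agree A y"
    unfolding * by (intro sum_mono) (use assms in \<open>auto simp: m_assoc of_bool_def\<close>)
  show "agree A (x \<otimes> y) \<le> disagree A x + agree A y"
    unfolding * by (intro sum_mono) (use assms in \<open>auto simp: m_assoc of_bool_def\<close>)
  show "agree A (x \<otimes> y) \<le> agree A x + disagree A y"
    unfolding * by (intro sum_mono) (use assms in \<open>auto simp: m_assoc of_bool_def\<close>)
qed

text \<open>The first hypothesis supplies the dichotomy that makes \<open>K\<close> a subgroup; the
  second keeps the generators out of \<open>K\<close>.\<close>

lemma few_mono_arcs_bipartite:
  assumes A1: "3 * mono_arcs A < n * h" and A2: "3 * mono_arcs A < n"
  shows "bipartite (cayley_graph G S)"
proof -
  define K where "K = {x \<in> carrier G. 3 * disagree A x < n}"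
  have K_carrier: "K \<subseteq> carrier G" by (auto simp: K_def)
  have notin_K: "3 * agree A x < n" if "x \<in> carrier G" "x \<notin> K" for x
    using agree_or_disagree_small[OF that(1) A1] that by (auto simp: K_def)
  \<comment> \<open>Non-membership in \<open>K\<close> is a homomorphism to the group of order two.
    Two counts below \<open>n / 3\<close> bound a third by less than \<open>2 * n / 3\<close>, so
    its complementary count exceeds \<open>n / 3\<close> and the dichotomy decides.\<close>
  have K_mult: "x \<otimes> y \<in> K \<longleftrightarrow> (x \<in> K \<longleftrightarrow> y \<in> K)" if x: "x \<in> carrier G" and y: "y \<in> carrier G" for x y
  proof -
    have xy: "x \<otimes> y \<in> carrier G" using x y by simp
    note t = disagree_translate[OF x y, of A] agree_plus_disagree[of A "x \<otimes> y"]
    have x': "3 * disagree A x < n" if "x \<in> K" using that by (simp add: K_def)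
    have y': "3 * disagree A y < n" if "y \<in> K" using that by (simp add: K_def)
    have xy': "3 * disagree A (x \<otimes> y) < n" if "x \<otimes> y \<in> K" using that by (simp add: K_def)
    note facts = t x' y' xy' notin_K[OF x] notin_K[OF y] notin_K[OF xy]
    show ?thesis
      by (cases "x \<in> K"; cases "y \<in> K"; cases "x \<otimes> y \<in> K") (use facts in auto)
  qed
  have "disagree A \<one> = 0" by (simp add: disagree_def)
  then have one_K: "\<one> \<in> K" using n_pos by (simp add: K_def)
  have K_inv: "inv x \<in> K \<longleftrightarrow> x \<in> K" if "x \<in> carrier G" for x
    using K_mult[of x "inv x"] one_K that by auto
  have S_K: "s \<notin> K" if s: "s \<in> S" for s
  proof
    assume sK: "s \<in> K"
    have sc: "s \<in> carrier G" using s by (rule S_carrier)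
    have finK: "finite K" using K_carrier finite_carrier finite_subset by blast
    define k where "k = real (card K)"
    have k: "0 < k" using one_K finK by (auto simp: k_def card_gt_0_iff)
    have K_sum: "3 * (\<Sum>x\<in>K. disagree A x) \<le> k * n"
    proof -
      have "3 * (\<Sum>x\<in>K. disagree A x) \<le> (\<Sum>x\<in>K. n)"
        unfolding sum_distrib_left by (intro sum_mono) (auto simp: K_def)
      then show ?thesis by (simp add: k_def)
    qed
    define B where "B = (\<Sum>g\<in>carrier G. of_bool ((g \<in> A) \<noteq> (g \<otimes> s \<in> A)) :: real)"
    have "of_bool (p = q) + of_bool (p \<noteq> q) = (1 :: real)" for p q :: bool by simp
    then have "(\<Sum>g\<in>carrier G. of_bool ((g \<in> A) = (g \<otimes> s \<in> A))) + B = n"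
      unfolding B_def sum.distrib[symmetric] by (simp only: sum_constant mult_1_right)
    then have "n - B = (\<Sum>g\<in>carrier G. of_bool ((g \<in> A) = (g \<otimes> s \<in> A)))" by simp
    also have "\<dots> \<le> mono_arcs A"
      unfolding mono_arcs_def using s finite_S by (intro sum_mono member_le_sum) auto
    finally have B: "n - B \<le> mono_arcs A" .
    \<comment> \<open>\<open>K\<close> is normal, so \<open>xg = y(gs)\<close> with \<open>y = x (g s\<^sup>-\<^sup>1 g\<^sup>-\<^sup>1)\<close> again in \<open>K\<close>.\<close>
    have second: "(\<Sum>x\<in>K. of_bool ((x \<otimes> g \<in> A) \<noteq> (g \<otimes> s \<in> A)))
      = (\<Sum>y\<in>K. of_bool ((g \<otimes> s \<in> A) \<noteq> (y \<otimes> (g \<otimes> s) \<in> A)) :: real)" if g: "g \<in> carrier G" for g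
    proof (rule sum.reindex_bij_witness[where
          i = "\<lambda>y. y \<otimes> (g \<otimes> s \<otimes> inv g)" and j = "\<lambda>x. x \<otimes> (g \<otimes> inv s \<otimes> inv g)"])
      have c: "g \<otimes> s \<otimes> inv g \<in> K" "g \<otimes> inv s \<otimes> inv g \<in> K"
        using g sc sK by (auto simp: K_mult K_inv)
      have inv1: "inv g \<otimes> (g \<otimes> z) = z" "inv s \<otimes> (s \<otimes> z) = z" "s \<otimes> (inv s \<otimes> z) = z"
        if "z \<in> carrier G" for z
        using that g sc by (simp_all add: m_assoc[symmetric])
      fix x assume x: "x \<in> K"
      then have xc: "x \<in> carrier G" using K_carrier by blast
      show "x \<otimes> (g \<otimes> s \<otimes> inv g) \<in> K" "x \<otimes> (g \<otimes> inv s \<otimes> inv g) \<in> K"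
        using K_mult[OF xc] c x g sc by auto
      show "x \<otimes> (g \<otimes> inv s \<otimes> inv g) \<otimes> (g \<otimes> s \<otimes> inv g) = x"
        "x \<otimes> (g \<otimes> s \<otimes> inv g) \<otimes> (g \<otimes> inv s \<otimes> inv g) = x"
        using xc g sc by (simp_all add: m_assoc inv1)
      have "x \<otimes> (g \<otimes> inv s \<otimes> inv g) \<otimes> (g \<otimes> s) = x \<otimes> g"
        using xc g sc by (simp add: m_assoc inv1)
      then show "of_bool ((g \<otimes> s \<in> A) \<noteq> (x \<otimes> (g \<otimes> inv s \<otimes> inv g) \<otimes> (g \<otimes> s) \<in> A))
        = (of_bool ((x \<otimes> g \<in> A) \<noteq> (g \<otimes> s \<in> A)) :: real)" by auto
    qed
    \<comment> \<open>Compare \<open>g\<close> with \<open>g \<otimes> s\<close> through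
      \<open>x \<otimes> g\<close>, averaged over \<open>x\<close> in \<open>K\<close>. Each half
      contributes at most \<open>k * n / 3\<close>, so \<open>B\<close> is at most
      \<open>2 * n / 3\<close>, whereas few arcs within a side force \<open>B\<close> above
      that.\<close>
    have "k * B = (\<Sum>g\<in>carrier G. \<Sum>x\<in>K. of_bool ((g \<in> A) \<noteq> (g \<otimes> s \<in> A)))"
      by (simp add: B_def k_def sum_distrib_left)
    also have "\<dots> \<le> (\<Sum>g\<in>carrier G. \<Sum>x\<in>K. of_bool ((g \<in> A) \<noteq> (x \<otimes> g \<in> A))
        + of_bool ((x \<otimes> g \<in> A) \<noteq> (g \<otimes> s \<in> A)))"
      by (intro sum_mono) (auto simp: of_bool_def)
    also have "\<dots> = (\<Sum>g\<in>carrier G. \<Sum>x\<in>K. of_bool ((g \<in> A) \<noteq> (x \<otimes> g \<in> A)))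
        + (\<Sum>g\<in>carrier G. \<Sum>x\<in>K. of_bool ((g \<otimes> s \<in> A) \<noteq> (x \<otimes> (g \<otimes> s) \<in> A)))"
      by (simp only: sum.distrib) (simp only: second cong: sum.cong)
    also have "(\<Sum>g\<in>carrier G. \<Sum>x\<in>K. of_bool ((g \<otimes> s \<in> A) \<noteq> (x \<otimes> (g \<otimes> s) \<in> A)))
      = (\<Sum>g\<in>carrier G. \<Sum>x\<in>K. of_bool ((g \<in> A) \<noteq> (x \<otimes> g \<in> A)) :: real)"
      by (rule sum_right_translate[OF sc])
    also have "(\<Sum>g\<in>carrier G. \<Sum>x\<in>K. of_bool ((g \<in> A) \<noteq> (x \<otimes> g \<in> A))) = (\<Sum>x\<in>K. disagree A x)"
      unfolding disagree_def by (rule sum.swap)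
    finally have "k * (3 * B) \<le> k * (2 * n)" using K_sum by simp
    then have "3 * B \<le> 2 * n" using k by simp
    then show False using A2 B by simp
  qed
  show ?thesis
    unfolding bipartite_def
  proof (intro exI conjI)
    show "pverts (cayley_graph G S) = K \<union> (carrier G - K)"
      using K_carrier by (auto simp: cayley_graph_def)
    show "K \<inter> (carrier G - K) = {}" by blast
    \<comment> \<open>As \<open>s\<close> lies outside \<open>K\<close>, right multiplication by
      \<open>s\<close> exchanges \<open>K\<close> and its complement.\<close>
    show "\<forall>(x, y)\<in>parcs (cayley_graph G S). \<not> (x \<in> K \<and> y \<in> K) \<and> \<not> (x \<in> carrier G - K \<and> y \<in> carrier G - K)"
      using S_K K_mult S_carrier by (auto simp: cayley_graph_def)
  qed
qed

section \<open>The Laplacian matrix as an operator on functions on the group\<close>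

lemma normalised_laplacian_carrier:
  "normalised_laplacian G S e \<in> carrier_mat (card (carrier G)) (card (carrier G))"
  by (intro carrier_matI)
    (simp_all add: normalised_laplacian_def normalised_adjacency_mat_def adjacency_mat_def cayley_graph_def)

lemma normalised_laplacian_mult_vec:
  assumes e: "bij_betw e {..<card (carrier G)} (carrier G)"
    and v: "v \<in> carrier_vec (card (carrier G))" and i: "i < card (carrier G)"
    and f: "\<And>j. j < card (carrier G) \<Longrightarrow> f (e j) = v $ j"
  shows "(normalised_laplacian G S e *\<^sub>v v) $ i = f (e i) - (\<Sum>s\<in>S. f (e i \<otimes> s)) / real (card S)"
proof -
  define m where "m = card (carrier G)"
  have ei: "e i \<in> carrier G" using e i by (auto simp: bij_betw_def)
  have verts: "pverts (cayley_graph G S) = carrier G" by (simp add: cayley_graph_def)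
  have entry: "normalised_laplacian G S e $$ (i, j) = (if i = j then 1 else 0)
      - 1 / real (card S) * (if (e i, e j) \<in> parcs (cayley_graph G S) then 1 else 0)"
    if "j < card (carrier G)" for j
    using i that
    by (simp add: normalised_laplacian_def normalised_adjacency_mat_def adjacency_mat_def verts)
  \<comment> \<open>By cancellation at most one generator leads from \<open>e i\<close> to
    \<open>e j\<close>, so the sum of indicators is again 0 or 1.\<close>
  have arc: "(if (e i, e j) \<in> parcs (cayley_graph G S) then 1 else 0) = (\<Sum>s\<in>S. of_bool (e j = e i \<otimes> s) :: real)"
    if "j < m" for j
  proof (cases "\<exists>s\<in>S. e j = e i \<otimes> s")
    case True
    then obtain t where t: "t \<in> S" "e j = e i \<otimes> t" by blast
    have "(\<Sum>s\<in>S. of_bool (e j = e i \<otimes> s)) = (\<Sum>s\<in>S. if s = t then 1 else 0 :: real)"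
      using t ei S_carrier by (intro sum.cong) auto
    moreover have "e j \<in> carrier G" using t ei S_carrier by simp
    ultimately show ?thesis using t ei finite_S by (auto simp: cayley_graph_def)
  qed (auto simp: cayley_graph_def)
  have "(normalised_laplacian G S e *\<^sub>v v) $ i
    = (\<Sum>j<m. ((if i = j then 1 else 0)
        - 1 / real (card S) * (if (e i, e j) \<in> parcs (cayley_graph G S) then 1 else 0)) * v $ j)"
    using v i normalised_laplacian_carrier[of e]
    by (auto simp: scalar_prod_def m_def lessThan_atLeast0 entry intro!: sum.cong)
  also have "\<dots> = (\<Sum>j<m. (if i = j then v $ j else 0)
        - (\<Sum>s\<in>S. of_bool (e j = e i \<otimes> s)) * f (e j) / real (card S))"
    by (intro sum.cong refl, subst arc) (auto simp: left_diff_distrib m_def f)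
  also have "\<dots> = f (e i) - (\<Sum>j<m. (\<Sum>s\<in>S. of_bool (e j = e i \<otimes> s)) * f (e j)) / real (card S)"
    using i by (simp add: sum_subtractf sum_divide_distrib f m_def)
  also have "(\<Sum>j<m. (\<Sum>s\<in>S. of_bool (e j = e i \<otimes> s)) * f (e j))
    = (\<Sum>y\<in>carrier G. (\<Sum>s\<in>S. of_bool (y = e i \<otimes> s)) * f y)"
    using e unfolding m_def by (rule sum.reindex_bij_betw)
  also have "\<dots> = (\<Sum>s\<in>S. f (e i \<otimes> s))" by (rule sum_neighbours[OF ei])
  finally show ?thesis .
qed

lemma laplacian_eigenvalue_less:
  assumes nb: "\<not> bipartite (cayley_graph G S)"
    and e: "bij_betw e {..<card (carrier G)} (carrier G)"
    and \<mu>: "eigenvalue (normalised_laplacian G S e) \<mu>"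
  shows "\<mu> < 2 - h ^ 4 / (2 ^ 9 * real (card S) ^ 8)"
proof (rule ccontr)
  assume "\<not> ?thesis"
  then have \<eta>: "2 - \<mu> \<le> h ^ 4 / (2 ^ 9 * real (card S) ^ 8)" by simp
  have dim: "dim_row (normalised_laplacian G S e) = card (carrier G)"
    using normalised_laplacian_carrier by blast
  obtain v where v: "v \<in> carrier_vec (card (carrier G))" "v \<noteq> 0\<^sub>v (card (carrier G))"
    and eq: "normalised_laplacian G S e *\<^sub>v v = \<mu> \<cdot>\<^sub>v v"
    using \<mu> by (auto simp: eigenvalue_def eigenvector_def dim)
  define f where "f g = v $ the_inv_into {..<card (carrier G)} e g" for g
  have fe: "f (e j) = v $ j" if "j < card (carrier G)" for j
    using that e by (simp add: f_def bij_betw_def the_inv_into_f_f)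
  have surj: "\<exists>i<card (carrier G). g = e i" if "g \<in> carrier G" for g
    using that e by (auto simp: bij_betw_def)
  have eig: "(\<Sum>s\<in>S. f (g \<otimes> s)) = real (card S) * ((2 - \<mu>) - 1) * f g" if g: "g \<in> carrier G" for g
  proof -
    obtain i where i: "i < card (carrier G)" "g = e i" using surj[OF g] by blast
    have "\<mu> * f g = f g - (\<Sum>s\<in>S. f (g \<otimes> s)) / real (card S)"
      using normalised_laplacian_mult_vec[OF e v(1) i(1) fe] i v eq by (simp add: fe)
    then show ?thesis using card_S_ge_1 by (simp add: field_simps)
  qed
  obtain i where i: "i < card (carrier G)" "v $ i \<noteq> 0"
    using v by (metis eq_vecI carrier_vecD index_zero_vec)
  have g0: "e i \<in> carrier G" "f (e i) \<noteq> 0" using i e by (auto simp: fe bij_betw_def)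
  define d where "d = real (card S)"
  have d: "1 \<le> d" "h \<le> d" using card_S_ge_1 cheeger_le_card_S by (auto simp: d_def)
  have A: "mono_arcs {g. 0 < f g} \<le> 33 / 256 * n * (h / d ^ 2)"
    unfolding d_def by (rule sign_set_mono_arcs[OF eig g0 \<eta>])
  \<comment> \<open>Both \<open>h / d ^ 2 \<le> h\<close> and \<open>h / d ^ 2 \<le> 1\<close> hold,
    and three times 33/256 is below 1, so both thresholds of \<open>few_mono_arcs_bipartite\<close>
    are met.\<close>
  have d2: "d \<le> d ^ 2" using d by (simp add: power2_eq_square)
  have "h / d ^ 2 \<le> h" using d d2 cheeger_pos by (simp add: divide_le_eq)
  then have "33 / 256 * n * (h / d ^ 2) \<le> 33 / 256 * (n * h)"
    using mult_left_mono[of "h / d ^ 2" h "33 / 256 * n"] by simp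
  moreover have "h / d ^ 2 \<le> 1" using d d2 by (simp add: divide_le_eq)
  then have "33 / 256 * n * (h / d ^ 2) \<le> 33 / 256 * n"
    using mult_left_mono[of "h / d ^ 2" 1 "33 / 256 * n"] by simp
  moreover have "0 < n * h" using n_pos cheeger_pos by simp
  ultimately have "3 * mono_arcs {g. 0 < f g} < n * h" "3 * mono_arcs {g. 0 < f g} < n"
    using A n_pos by linarith+
  then show False using few_mono_arcs_bipartite nb by blast
qed

text \<open>Constant functions are harmonic. This makes the real spectrum nonempty, so that its
  \<open>Max\<close> is an actual eigenvalue.\<close>

lemma zero_eigenvalue_laplacian:
  assumes e: "bij_betw e {..<card (carrier G)} (carrier G)"
  shows "eigenvalue (normalised_laplacian G S e) 0"
proof -
  define v where "v = vec (card (carrier G)) (\<lambda>_. 1 :: real)"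
  have v: "v \<in> carrier_vec (card (carrier G))" by (simp add: v_def)
  have dim: "dim_row (normalised_laplacian G S e) = card (carrier G)"
    using normalised_laplacian_carrier by blast
  have "normalised_laplacian G S e *\<^sub>v v = 0 \<cdot>\<^sub>v v"
  proof (rule eq_vecI)
    fix i assume "i < dim_vec (0 \<cdot>\<^sub>v v)"
    then have i: "i < card (carrier G)" by (simp add: v_def)
    show "(normalised_laplacian G S e *\<^sub>v v) $ i = (0 \<cdot>\<^sub>v v) $ i"
      using normalised_laplacian_mult_vec[OF e v i, of "\<lambda>_. 1"] i card_S_ge_1 by (simp add: v_def)
  qed (simp add: dim v_def)
  moreover have "v \<noteq> 0\<^sub>v (card (carrier G))"
  proof
    assume "v = 0\<^sub>v (card (carrier G))"
    then have "v $ 0 = 0\<^sub>v (card (carrier G)) $ 0" by simp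
    then show False using n_pos by (simp add: v_def)
  qed
  ultimately show ?thesis using v by (auto simp: eigenvalue_def eigenvector_def dim)
qed

end

theorem theorem2p11:
  fixes G :: "('a, 'b) monoid_scheme" and S :: "'a set" and d :: nat and e :: "nat \<Rightarrow> 'a"
  assumes "group G" and "finite (carrier G)" and "card (carrier G) \<noteq> 3"
    and "S \<subseteq> carrier G"
    and "\<forall>s\<in>S. inv\<^bsub>G\<^esub> s \<in> S"
    and "generate G S = carrier G"
    and "\<one>\<^bsub>G\<^esub> \<notin> S"
    and "card S = d"
    and "\<not> bipartite (cayley_graph G S)"
    and "bij_betw e {..<card (carrier G)} (carrier G)"
  shows "Max (spectrum (normalised_laplacian G S e))
           < 2 - vertex_cheeger G S ^ 4 / (2 ^ 9 * real d ^ 8)"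
proof -
  \<comment> \<open>Without generators the graph has no arcs and is bipartite, with the whole group
    as one side.\<close>
  have "S \<noteq> {}"
  proof
    assume "S = {}"
    then have "bipartite (cayley_graph G S)"
      unfolding bipartite_def
      by (intro exI[of _ "carrier G"] exI[of _ "{}"]) (auto simp: cayley_graph_def)
    then show False using assms by blast
  qed
  then interpret finite_cayley G S
    using assms by (intro finite_cayley.intro finite_cayley_axioms.intro) auto
  have "finite (spectrum (normalised_laplacian G S e))"
    by (rule card_finite_spectrum[OF normalised_laplacian_carrier])
  moreover have "spectrum (normalised_laplacian G S e) \<noteq> {}"
    using zero_eigenvalue_laplacian assms by (auto simp: spectrum_def)
  ultimately have "Max (spectrum (normalised_laplacian G S e)) \<in> spectrum (normalised_laplacian G S e)"
    by (rule Max_in)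
  then show ?thesis
    using laplacian_eigenvalue_less assms by (auto simp: spectrum_def)
qed

end
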